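(* Let $\mathrm{st}$ be a statistic on permutations. (1) If $\mathrm{st}$ is weakly shuffle-compatible on permutations, then the shifted shuffle algebra $\mathcal{A}^{\mathfrak{S}}_{\mathrm{st}}$ is a quotient of $\mathrm{FQSym}$. (2) If $\mathrm{st}$ is shuffle-compatible on permutations, then the shuffle algebra $\mathcal{A}^{\mathfrak{P}}_{\mathrm{st}}$ is a quotient of $\mathrm{FQSym}$. Here "quotient" means isomorphic, as a $\mathbb{Q}$-algebra, to $\mathrm{FQSym}/I$ for some two-sided ideal $I$.
   Context: All algebras are over $\mathbb{Q}$. A permutation of length $n$ is a sequence $\pi=(\pi_1,\dots,\pi_n)$ of distinct positive integers; $|\pi|=n$. $\mathfrak{P}$ is the set of all permutations (all lengths $n\ge 0$), and $\mathfrak{S}=\bigcup_n\mathfrak{S}_n$, where $\mathfrak{S}_n\subset\mathfrak{P}$ is the set of permutations with set of entries $[n]=\{1,\dots,n\}$. The standardization $\mathrm{std}(\pi)\in\mathfrak{S}_n$ is obtained by replacing the $j$-th smallest entry of $\pi$ by $j$. A permutation statistic is a function on $\mathfrak{P}$. For disjoint permutations $\tau,\theta$ (no common entries), $\mathrm{Sh}(\tau,\theta)$ is the set of all shuffles: permutations whose entries are those of $\tau$ and $\theta$ together and which contain $\tau$ and $\theta$ as subwords. For $\tau\in\mathfrak{S}_n,\theta\in\mathfrak{S}_m$ the shifted shuffle is $\overrightarrow{\mathrm{Sh}}(\tau,\theta)=\mathrm{Sh}(\tau,\theta[n])$, where $\theta[n]=(\theta_1+n,\dots,\theta_m+n)$.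 $\mathrm{st}$ is shuffle-compatible on permutations if (i) for all disjoint $\tau,\theta\in\mathfrak{P}$ the multiset $\{\{\mathrm{st}(\pi):\pi\in \mathrm{Sh}(\tau,\theta)\}\}$ depends only on $\mathrm{st}(\tau),\mathrm{st}(\theta),|\tau|,|\theta|$; and (ii) $\mathrm{std}(\tau)=\mathrm{std}(\theta)$ implies $\mathrm{st}(\tau)=\mathrm{st}(\theta)$. $\mathrm{st}$ is weakly shuffle-compatible on permutations if for all $\tau,\theta\in\mathfrak{S}$ the multiset $\{\{\mathrm{st}(\pi):\pi\in\overrightarrow{\mathrm{Sh}}(\tau,\theta)\}\}$ depends only on $\mathrm{st}(\tau),\mathrm{st}(\theta),|\tau|,|\theta|$. For $X\in\{\mathfrak{P},\mathfrak{S}\}$ and $\pi\in X$ let $[\pi]^X_{\mathrm{st}}=\{\tau\in X:\mathrm{st}(\tau)=\mathrm{st}(\pi),|\tau|=|\pi|\}$. If $\mathrm{st}$ is shuffle-compatible, $\mathcal{A}^{\mathfrak{P}}_{\mathrm{st}}$ is the algebra with basis the classes $[\pi]^{\mathfrak{P}}_{\mathrm{st}}$ and product $[\tau]^{\mathfrak{P}}_{\mathrm{st}}[\theta]^{\mathfrak{P}}_{\mathrm{st}}=\sum_{\pi\in \mathrm{Sh}(\tau,\theta)}[\pi]^{\mathfrak{P}}_{\mathrm{st}}$, for disjoint representatives $\tau,\theta$. If $\mathrm{st}$ is weakly shuffle-compatible, $\mathcal{A}^{\mathfrak{S}}_{\mathrm{st}}$ is the algebra with basis the classes $[\pi]^{\mathfrak{S}}_{\mathrm{st}}$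 and product $[\tau]^{\mathfrak{S}}_{\mathrm{st}}[\theta]^{\mathfrak{S}}_{\mathrm{st}}=\sum_{\pi\in\overrightarrow{\mathrm{Sh}}(\tau,\theta)}[\pi]^{\mathfrak{S}}_{\mathrm{st}}$. $\mathrm{FQSym}$ (Malvenuto–Reutenauer algebra) has basis $\{\mathbf{F}_\pi\}_{\pi\in\mathfrak{S}}$ and product $\mathbf{F}_\tau\mathbf{F}_\theta=\sum_{\pi\in\overrightarrow{\mathrm{Sh}}(\tau,\theta)}\mathbf{F}_\pi$. *)

theory Defs
  imports
    Complex_Main
    "HOL-Algebra.QuotRing"
    "HOL-Algebra.Module"
    "HOL-Library.Multiset"
    "HOL-Library.Sublist"
    "HOL-Library.Poly_Mapping"
begin

section \<open>Permutations and shuffles\<close>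

definition perms :: "nat list set"  (\<open>\<PP>\<close>)
  where "\<PP> = {\<pi>. distinct \<pi> \<and> 0 \<notin> set \<pi>}"

definition std_perms :: "nat list set"  (\<open>\<SS>\<close>)
  where "\<SS> = {\<pi>. distinct \<pi> \<and> set \<pi> = {1..length \<pi>}}"

definition std :: "nat list \<Rightarrow> nat list"
  where "std \<pi> = map (\<lambda>x. card {y \<in> set \<pi>. y \<le> x}) \<pi>"

definition disjoint_perms :: "nat list \<Rightarrow> nat list \<Rightarrow> bool"
  where "disjoint_perms \<tau> \<theta> \<longleftrightarrow> set \<tau> \<inter> set \<theta> = {}"

text \<open>
  The set of shuffles of two disjoint permutations is the library's \<^const>\<open>shuffles\<close>; this is the
  description by entries and subwords.
\<close>

lemma shuffles_eq_subwords:
  assumes "\<tau> \<in> \<PP>" "\<theta> \<in> \<PP>" "disjoint_perms \<tau> \<theta>"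
  shows "shuffles \<tau> \<theta> = {\<pi> \<in> \<PP>. set \<pi> = set \<tau> \<union> set \<theta> \<and> subseq \<tau> \<pi> \<and> subseq \<theta> \<pi>}"
proof -
  have sub: "subseq \<tau> \<pi> \<and> subseq \<theta> \<pi>" if "\<pi> \<in> shuffles \<tau> \<theta>" for \<pi> \<tau> \<theta> :: "nat list"
    using that
  proof (induction \<tau> \<theta> arbitrary: \<pi> rule: shuffles.induct)
    case (3 x xs y ys)
    then show ?case by (auto intro: subseq_Cons')
  qed auto
  have conv: "\<pi> \<in> shuffles \<tau> \<theta>"
    if "distinct \<pi>" "set \<pi> = set \<tau> \<union> set \<theta>" "set \<tau> \<inter> set \<theta> = {}" "subseq \<tau> \<pi>" "subseq \<theta> \<pi>"
    for \<pi> \<tau> \<theta> :: "nat list"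
    using that
  proof (induction \<pi> arbitrary: \<tau> \<theta>)
    case Nil
    then show ?case by auto
  next
    case (Cons z \<pi>)
    have step: "z # \<pi> \<in> shuffles (z # \<alpha>) \<beta>"
      if h: "set (z # \<pi>) = set (z # \<alpha>) \<union> set \<beta>" "set (z # \<alpha>) \<inter> set \<beta> = {}"
        "subseq (z # \<alpha>) (z # \<pi>)" "subseq \<beta> (z # \<pi>)" for \<alpha> \<beta>
    proof -
      have a: "subseq \<alpha> \<pi>" using h(3) by simp
      have "subseq \<beta> \<pi>" using h(2,4) by (cases \<beta>) (auto simp: subseq_Cons2_iff split: if_splits)
      moreover have "z \<notin> set \<alpha>" using Cons.prems(1) list_emb_set[OF a] by auto
      then have "set \<pi> = set \<alpha> \<union> set \<beta>" using h(1,2) Cons.prems(1) by auto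
      ultimately have "\<pi> \<in> shuffles \<alpha> \<beta>" using Cons.IH[of \<alpha> \<beta>] Cons.prems(1) h(2) a by auto
      then show ?thesis by (rule Cons_in_shuffles_leftI)
    qed
    have dest: "\<exists>\<alpha>'. \<alpha> = z # \<alpha>'" if s: "subseq \<alpha> (z # \<pi>)" and m: "z \<in> set \<alpha>" for \<alpha>
    proof (cases \<alpha>)
      case Nil
      then show ?thesis using m by simp
    next
      case (Cons a \<alpha>')
      have "a = z"
      proof (rule ccontr)
        assume "a \<noteq> z"
        then have "subseq \<alpha> \<pi>" using s Cons by (simp add: subseq_Cons2_iff)
        from list_emb_set[OF this m] have "z \<in> set \<pi>" by auto
        then show False using Cons.prems(1) by simp
      qed
      then show ?thesis using Cons by simp
    qed
    have "z \<in> set \<tau> \<or> z \<in> set \<theta>" using Cons.prems(2) by auto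
    then show ?case
    proof
      assume "z \<in> set \<tau>"
      then obtain \<alpha> where "\<tau> = z # \<alpha>" using dest Cons.prems(4) by blast
      then show ?thesis using step[of \<alpha> \<theta>] Cons.prems by simp
    next
      assume "z \<in> set \<theta>"
      then obtain \<beta> where "\<theta> = z # \<beta>" using dest Cons.prems(5) by blast
      then show ?thesis using step[of \<beta> \<tau>] Cons.prems by (auto simp: shuffles_commutes[of \<tau>])
    qed
  qed
  show ?thesis
  proof (intro equalityI subsetI)
    fix \<pi> assume h: "\<pi> \<in> shuffles \<tau> \<theta>"
    then show "\<pi> \<in> {\<pi> \<in> \<PP>. set \<pi> = set \<tau> \<union> set \<theta> \<and> subseq \<tau> \<pi> \<and> subseq \<theta> \<pi>}"
      using assms sub[OF h] distinct_disjoint_shuffles[of \<tau> \<theta> \<pi>] set_shuffles[OF h]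
      by (simp add: perms_def disjoint_perms_def)
  next
    fix \<pi> assume "\<pi> \<in> {\<pi> \<in> \<PP>. set \<pi> = set \<tau> \<union> set \<theta> \<and> subseq \<tau> \<pi> \<and> subseq \<theta> \<pi>}"
    then show "\<pi> \<in> shuffles \<tau> \<theta>"
      using assms conv[of \<pi> \<tau> \<theta>] by (simp add: perms_def disjoint_perms_def)
  qed
qed

definition shifted_shuffles :: "nat list \<Rightarrow> nat list \<Rightarrow> nat list set"
  where "shifted_shuffles \<tau> \<theta> = shuffles \<tau> (map (\<lambda>x. x + length \<tau>) \<theta>)"


section \<open>Shuffle-compatibility\<close>

text \<open>
  A statistic is represented by a function on all lists of natural numbers; its values outside
  \<^const>\<open>perms\<close> are never used.
\<close>

definition shuffle_compatible :: "(nat list \<Rightarrow> 'a) \<Rightarrow> bool"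
  where "shuffle_compatible st \<longleftrightarrow>
    (\<forall>\<tau>\<in>\<PP>. \<forall>\<theta>\<in>\<PP>. \<forall>\<tau>'\<in>\<PP>. \<forall>\<theta>'\<in>\<PP>.
       disjoint_perms \<tau> \<theta> \<and> disjoint_perms \<tau>' \<theta>' \<and>
       st \<tau> = st \<tau>' \<and> st \<theta> = st \<theta>' \<and> length \<tau> = length \<tau>' \<and> length \<theta> = length \<theta>' \<longrightarrow>
       image_mset st (mset_set (shuffles \<tau> \<theta>)) = image_mset st (mset_set (shuffles \<tau>' \<theta>'))) \<and>
    (\<forall>\<tau>\<in>\<PP>. \<forall>\<theta>\<in>\<PP>. std \<tau> = std \<theta> \<longrightarrow> st \<tau> = st \<theta>)"

definition weakly_shuffle_compatible :: "(nat list \<Rightarrow> 'a) \<Rightarrow> bool"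
  where "weakly_shuffle_compatible st \<longleftrightarrow>
    (\<forall>\<tau>\<in>\<SS>. \<forall>\<theta>\<in>\<SS>. \<forall>\<tau>'\<in>\<SS>. \<forall>\<theta>'\<in>\<SS>.
       st \<tau> = st \<tau>' \<and> st \<theta> = st \<theta>' \<and> length \<tau> = length \<tau>' \<and> length \<theta> = length \<theta>' \<longrightarrow>
       image_mset st (mset_set (shifted_shuffles \<tau> \<theta>)) =
       image_mset st (mset_set (shifted_shuffles \<tau>' \<theta>')))"

definition st_class :: "nat list set \<Rightarrow> (nat list \<Rightarrow> 'a) \<Rightarrow> nat list \<Rightarrow> nat list set"
  where "st_class X st \<pi> = {\<tau> \<in> X. st \<tau> = st \<pi> \<and> length \<tau> = length \<pi>}"


section \<open>Algebras over the rational numbers\<close>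

text \<open>
  The library's locale \<^locale>\<open>algebra\<close> demands commutativity, so a \<open>\<rat>\<close>-algebra is represented
  directly by a ring record with a scalar multiplication by rational numbers.
\<close>

type_synonym 'b rat_algebra = "(rat, 'b) module"

definition scale :: "rat \<Rightarrow> ('b \<Rightarrow>\<^sub>0 rat) \<Rightarrow> ('b \<Rightarrow>\<^sub>0 rat)"
  where "scale r f = Poly_Mapping.map (\<lambda>c. r * c) f"

text \<open>
  The \<open>\<rat>\<close>-vector space with basis \<open>B\<close>, with the bilinear multiplication whose value on basis
  elements \<open>b\<close>, \<open>c\<close> is \<open>m b c\<close>, and with the basis element \<open>e\<close> as unit.
\<close>

definition algebra_on_basis ::
    "'b set \<Rightarrow> ('b \<Rightarrow> 'b \<Rightarrow> ('b \<Rightarrow>\<^sub>0 rat)) \<Rightarrow> 'b \<Rightarrow> ('b \<Rightarrow>\<^sub>0 rat) rat_algebra"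
  where "algebra_on_basis B m e =
    \<lparr>carrier = {f. Poly_Mapping.keys f \<subseteq> B},
     monoid.mult = (\<lambda>f g. \<Sum>b\<in>Poly_Mapping.keys f. \<Sum>c\<in>Poly_Mapping.keys g.
               scale (Poly_Mapping.lookup f b * Poly_Mapping.lookup g c) (m b c)),
     one = Poly_Mapping.single e 1,
     zero = 0,
     add = (+),
     smult = scale\<rparr>"

text \<open>
  In a unital algebra a two-sided ring ideal is closed under scalars, so the scalar multiplication
  descends to the quotient ring. As in \<^const>\<open>rcoset_mult\<close>, the union avoids choosing a
  representative of the coset \<open>X\<close>.
\<close>

definition quotient_algebra :: "'b rat_algebra \<Rightarrow> 'b set \<Rightarrow> 'b set rat_algebra"
  where "quotient_algebra A I =
    \<lparr>carrier = carrier (A Quot I), monoid.mult = monoid.mult (A Quot I), one = one (A Quot I),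
     zero = zero (A Quot I), add = add (A Quot I),
     smult = (\<lambda>r X. \<Union>x\<in>X. I +>\<^bsub>A\<^esub> (r \<odot>\<^bsub>A\<^esub> x))\<rparr>"

definition algebra_iso :: "'b rat_algebra \<Rightarrow> 'c rat_algebra \<Rightarrow> ('b \<Rightarrow> 'c) set"
  where "algebra_iso A B =
    {h \<in> ring_iso A B. \<forall>r. \<forall>x\<in>carrier A. h (r \<odot>\<^bsub>A\<^esub> x) = r \<odot>\<^bsub>B\<^esub> h x}"

definition is_quotient_of :: "'b rat_algebra \<Rightarrow> 'c rat_algebra \<Rightarrow> bool"
  where "is_quotient_of A B \<longleftrightarrow> (\<exists>I. ideal I B \<and> algebra_iso A (quotient_algebra B I) \<noteq> {})"


section \<open>The Malvenuto-Reutenauer algebra and the algebras of a statistic\<close>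

definition FQSym :: "(nat list \<Rightarrow>\<^sub>0 rat) rat_algebra"
  where "FQSym = algebra_on_basis \<SS>
    (\<lambda>\<tau> \<theta>. \<Sum>\<pi>\<in>shifted_shuffles \<tau> \<theta>. Poly_Mapping.single \<pi> 1) []"

text \<open>
  The product of two classes is the common value, over all (disjoint) representatives, of the sum
  of the classes of their shuffles. It exists and is unique for a (weakly) shuffle-compatible
  statistic; see \<open>shuffle_product_eq\<close>, \<open>disjoint_representatives\<close> and
  \<open>shifted_shuffle_product_eq\<close> below.
\<close>

definition shuffle_product ::
    "(nat list \<Rightarrow> 'a) \<Rightarrow> nat list set \<Rightarrow> nat list set \<Rightarrow> (nat list set \<Rightarrow>\<^sub>0 rat)"
  where "shuffle_product st C D =
    (THE p. \<forall>\<tau>\<in>C. \<forall>\<theta>\<in>D. disjoint_perms \<tau> \<theta> \<longrightarrow>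
       p = (\<Sum>\<pi>\<in>shuffles \<tau> \<theta>. Poly_Mapping.single (st_class \<PP> st \<pi>) 1))"

definition shuffle_algebra :: "(nat list \<Rightarrow> 'a) \<Rightarrow> (nat list set \<Rightarrow>\<^sub>0 rat) rat_algebra"
  where "shuffle_algebra st =
    algebra_on_basis (st_class \<PP> st ` \<PP>) (shuffle_product st) (st_class \<PP> st [])"

definition shifted_shuffle_product ::
    "(nat list \<Rightarrow> 'a) \<Rightarrow> nat list set \<Rightarrow> nat list set \<Rightarrow> (nat list set \<Rightarrow>\<^sub>0 rat)"
  where "shifted_shuffle_product st C D =
    (THE p. \<forall>\<tau>\<in>C. \<forall>\<theta>\<in>D.
       p = (\<Sum>\<pi>\<in>shifted_shuffles \<tau> \<theta>. Poly_Mapping.single (st_class \<SS> st \<pi>) 1))"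

definition shifted_shuffle_algebra :: "(nat list \<Rightarrow> 'a) \<Rightarrow> (nat list set \<Rightarrow>\<^sub>0 rat) rat_algebra"
  where "shifted_shuffle_algebra st =
    algebra_on_basis (st_class \<SS> st ` \<SS>) (shifted_shuffle_product st) (st_class \<SS> st [])"

lemma sum_classes_eq:
  assumes eq: "image_mset st (mset_set (shuffles \<tau> \<theta>)) = image_mset st (mset_set (shuffles \<tau>' \<theta>'))"
    and len: "length \<tau> = length \<tau>'" "length \<theta> = length \<theta>'"
  shows "(\<Sum>\<pi>\<in>shuffles \<tau> \<theta>. Poly_Mapping.single (st_class X st \<pi>) (1::rat)) =
         (\<Sum>\<pi>\<in>shuffles \<tau>' \<theta>'. Poly_Mapping.single (st_class X st \<pi>) 1)"
proof -
  define g where "g s = Poly_Mapping.single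
    {\<sigma> \<in> X. st \<sigma> = s \<and> length \<sigma> = length \<tau> + length \<theta>} (1::rat)" for s
  have *: "(\<Sum>\<pi>\<in>shuffles \<alpha> \<beta>. Poly_Mapping.single (st_class X st \<pi>) (1::rat)) =
      sum_mset (image_mset g (image_mset st (mset_set (shuffles \<alpha> \<beta>))))"
    if "length \<alpha> = length \<tau>" "length \<beta> = length \<theta>" for \<alpha> \<beta>
  proof -
    have "(\<Sum>\<pi>\<in>shuffles \<alpha> \<beta>. Poly_Mapping.single (st_class X st \<pi>) (1::rat)) =
        (\<Sum>\<pi>\<in>shuffles \<alpha> \<beta>. g (st \<pi>))"
      using that by (intro sum.cong refl) (simp add: g_def st_class_def length_shuffles)
    also have "\<dots> = sum_mset (image_mset g (image_mset st (mset_set (shuffles \<alpha> \<beta>))))"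
      by (simp add: sum_unfold_sum_mset multiset.map_comp comp_def)
    finally show ?thesis .
  qed
  show ?thesis using *[of \<tau> \<theta>] *[of \<tau>' \<theta>'] eq len by simp
qed

lemma shuffle_product_eq:
  assumes sc: "shuffle_compatible st" and \<tau>: "\<tau> \<in> \<PP>" and \<theta>: "\<theta> \<in> \<PP>" and disj: "disjoint_perms \<tau> \<theta>"
  shows "shuffle_product st (st_class \<PP> st \<tau>) (st_class \<PP> st \<theta>) =
    (\<Sum>\<pi>\<in>shuffles \<tau> \<theta>. Poly_Mapping.single (st_class \<PP> st \<pi>) 1)"
  unfolding shuffle_product_def
proof (rule the_equality)
  show "\<forall>\<tau>'\<in>st_class \<PP> st \<tau>. \<forall>\<theta>'\<in>st_class \<PP> st \<theta>. disjoint_perms \<tau>' \<theta>' \<longrightarrow>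
    (\<Sum>\<pi>\<in>shuffles \<tau> \<theta>. Poly_Mapping.single (st_class \<PP> st \<pi>) (1::rat)) =
    (\<Sum>\<pi>\<in>shuffles \<tau>' \<theta>'. Poly_Mapping.single (st_class \<PP> st \<pi>) 1)"
  proof (intro ballI impI)
    fix \<tau>' \<theta>'
    assume h: "\<tau>' \<in> st_class \<PP> st \<tau>" "\<theta>' \<in> st_class \<PP> st \<theta>" "disjoint_perms \<tau>' \<theta>'"
    show "(\<Sum>\<pi>\<in>shuffles \<tau> \<theta>. Poly_Mapping.single (st_class \<PP> st \<pi>) (1::rat)) =
      (\<Sum>\<pi>\<in>shuffles \<tau>' \<theta>'. Poly_Mapping.single (st_class \<PP> st \<pi>) 1)"
    proof (rule sum_classes_eq)
      show "image_mset st (mset_set (shuffles \<tau> \<theta>)) = image_mset st (mset_set (shuffles \<tau>' \<theta>'))"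
        using sc[unfolded shuffle_compatible_def, THEN conjunct1, rule_format, of \<tau> \<theta> \<tau>' \<theta>']
          \<tau> \<theta> disj h
        by (simp add: st_class_def)
    qed (use h in \<open>auto simp: st_class_def\<close>)
  qed
qed (use \<tau> \<theta> disj in \<open>auto simp: st_class_def\<close>)

lemma disjoint_representatives:
  assumes sc: "shuffle_compatible st" and \<tau>: "\<tau> \<in> \<PP>" and \<theta>: "\<theta> \<in> \<PP>"
  obtains \<theta>' where "\<theta>' \<in> \<PP>" "st_class \<PP> st \<theta>' = st_class \<PP> st \<theta>" "disjoint_perms \<tau> \<theta>'"
proof -
  define n where "n = Max (insert 0 (set \<tau>))"
  define \<theta>' where "\<theta>' = map (\<lambda>x. x + n) \<theta>"
  have P: "\<theta>' \<in> \<PP>" using \<theta> by (auto simp: \<theta>'_def perms_def distinct_map inj_on_def)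
  have "x + n \<notin> set \<tau>" if "x \<in> set \<theta>" for x
  proof
    assume "x + n \<in> set \<tau>"
    then have "x + n \<le> n" unfolding n_def by (intro Max_ge) auto
    then show False using that \<theta> by (cases x) (auto simp: perms_def)
  qed
  then have disj: "disjoint_perms \<tau> \<theta>'" by (auto simp: disjoint_perms_def \<theta>'_def)
  have "card {y \<in> (\<lambda>x. x + n) ` set \<theta>. y \<le> x + n} = card {y \<in> set \<theta>. y \<le> x}" for x
  proof -
    have "{y \<in> (\<lambda>x. x + n) ` set \<theta>. y \<le> x + n} = (\<lambda>x. x + n) ` {y \<in> set \<theta>. y \<le> x}" by auto
    then show ?thesis by (simp add: card_image inj_on_def)
  qed
  then have "std \<theta>' = std \<theta>" by (simp add: std_def \<theta>'_def)
  then have "st \<theta>' = st \<theta>" using sc P \<theta> unfolding shuffle_compatible_def by blast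
  then have "st_class \<PP> st \<theta>' = st_class \<PP> st \<theta>" by (simp add: st_class_def \<theta>'_def)
  from that[OF P this disj] show ?thesis .
qed

lemma shifted_shuffle_product_eq:
  assumes wsc: "weakly_shuffle_compatible st" and \<tau>: "\<tau> \<in> \<SS>" and \<theta>: "\<theta> \<in> \<SS>"
  shows "shifted_shuffle_product st (st_class \<SS> st \<tau>) (st_class \<SS> st \<theta>) =
    (\<Sum>\<pi>\<in>shifted_shuffles \<tau> \<theta>. Poly_Mapping.single (st_class \<SS> st \<pi>) 1)"
  unfolding shifted_shuffle_product_def
proof (rule the_equality)
  show "\<forall>\<tau>'\<in>st_class \<SS> st \<tau>. \<forall>\<theta>'\<in>st_class \<SS> st \<theta>.
    (\<Sum>\<pi>\<in>shifted_shuffles \<tau> \<theta>. Poly_Mapping.single (st_class \<SS> st \<pi>) (1::rat)) =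
    (\<Sum>\<pi>\<in>shifted_shuffles \<tau>' \<theta>'. Poly_Mapping.single (st_class \<SS> st \<pi>) 1)"
  proof (intro ballI)
    fix \<tau>' \<theta>'
    assume h: "\<tau>' \<in> st_class \<SS> st \<tau>" "\<theta>' \<in> st_class \<SS> st \<theta>"
    show "(\<Sum>\<pi>\<in>shifted_shuffles \<tau> \<theta>. Poly_Mapping.single (st_class \<SS> st \<pi>) (1::rat)) =
      (\<Sum>\<pi>\<in>shifted_shuffles \<tau>' \<theta>'. Poly_Mapping.single (st_class \<SS> st \<pi>) 1)"
      unfolding shifted_shuffles_def
    proof (rule sum_classes_eq)
      show "image_mset st (mset_set (shuffles \<tau> (map (\<lambda>x. x + length \<tau>) \<theta>))) =
        image_mset st (mset_set (shuffles \<tau>' (map (\<lambda>x. x + length \<tau>') \<theta>')))"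
        using wsc[unfolded weakly_shuffle_compatible_def, rule_format, of \<tau> \<theta> \<tau>' \<theta>'] \<tau> \<theta> h
        by (simp add: st_class_def shifted_shuffles_def)
    qed (use h in \<open>auto simp: st_class_def\<close>)
  qed
next
  fix p
  assume p: "\<forall>\<tau>'\<in>st_class \<SS> st \<tau>. \<forall>\<theta>'\<in>st_class \<SS> st \<theta>.
    p = (\<Sum>\<pi>\<in>shifted_shuffles \<tau>' \<theta>'. Poly_Mapping.single (st_class \<SS> st \<pi>) 1)"
  have "\<tau> \<in> st_class \<SS> st \<tau>" "\<theta> \<in> st_class \<SS> st \<theta>"
    using \<tau> \<theta> by (simp_all add: st_class_def)
  from p[rule_format, OF this]
  show "p = (\<Sum>\<pi>\<in>shifted_shuffles \<tau> \<theta>. Poly_Mapping.single (st_class \<SS> st \<pi>) 1)" .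
qed

end

theory Submission
  imports Defs
begin

text \<open>
  Sending \<open>F\<^sub>\<pi>\<close> to the class of \<open>\<pi>\<close> is a homomorphism from \<open>FQSym\<close> because the structure
  constants match. It is onto since every \<open>\<PP>\<close>-class contains the standardization of each of its
  elements, and a shift \<open>\<theta>[n]\<close>, having the same standardization as \<open>\<theta>\<close>, is a representative of
  the class of \<open>\<theta>\<close> disjoint from \<open>\<SS>\<^sub>n\<close>. That \<open>FQSym\<close> is a ring needs associativity: both
  bracketings enumerate, without repetition, the words that restrict to the three given ones on
  their letters. The statistic algebras are then rings as images of \<open>FQSym\<close>.
\<close>

section \<open>Linear extension\<close>

lemma lookup_scale: "Poly_Mapping.lookup (scale r f) k = r * Poly_Mapping.lookup f k"
  unfolding scale_def by transfer (simp add: when_def)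

lemma scale_add_right: "scale r (f + g) = scale r f + scale r g"
  by (rule poly_mapping_eqI) (simp add: lookup_scale lookup_add algebra_simps)

lemma scale_add_left: "scale (r + s) f = scale r f + scale s f"
  by (rule poly_mapping_eqI) (simp add: lookup_scale lookup_add algebra_simps)

lemma scale_scale: "scale r (scale s f) = scale (r * s) f"
  by (rule poly_mapping_eqI) (simp add: lookup_scale)

lemma scale_one [simp]: "scale 1 f = f"
  by (rule poly_mapping_eqI) (simp add: lookup_scale)

lemma scale_zero [simp]: "scale 0 f = 0" "scale r 0 = 0"
  by (rule poly_mapping_eqI, simp add: lookup_scale)+

lemma scale_sum: "scale r (\<Sum>i\<in>I. f i) = (\<Sum>i\<in>I. scale r (f i))"
  by (induction I rule: infinite_finite_induct) (simp_all add: scale_add_right)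

lemma keys_scale: "Poly_Mapping.keys (scale r f) \<subseteq> Poly_Mapping.keys f"
  by (auto simp: in_keys_iff lookup_scale)

text \<open>Nesting two of these gives the multiplication of \<open>algebra_on_basis\<close>, and a
  single one gives the homomorphisms below. Identities between elements thus reduce to identities
  between basis elements.\<close>

definition linear_extension :: "('b \<Rightarrow> ('c \<Rightarrow>\<^sub>0 rat)) \<Rightarrow> ('b \<Rightarrow>\<^sub>0 rat) \<Rightarrow> ('c \<Rightarrow>\<^sub>0 rat)"
  where "linear_extension \<phi> f =
    (\<Sum>b\<in>Poly_Mapping.keys f. scale (Poly_Mapping.lookup f b) (\<phi> b))"

text \<open>Basis elements of \<open>S\<close> outside the keys of \<open>f\<close> have coefficient
  0. Elements with different keys can thus be summed over one index set.\<close>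

lemma linear_extension_superset:
  assumes "finite S" "Poly_Mapping.keys f \<subseteq> S"
  shows "linear_extension \<phi> f = (\<Sum>b\<in>S. scale (Poly_Mapping.lookup f b) (\<phi> b))"
  unfolding linear_extension_def
  by (rule sum.mono_neutral_left) (use assms in \<open>auto simp: in_keys_iff\<close>)

lemma linear_extension_cong:
  assumes "\<And>b. b \<in> Poly_Mapping.keys f \<Longrightarrow> \<phi> b = \<psi> b"
  shows "linear_extension \<phi> f = linear_extension \<psi> f"
  using assms by (simp add: linear_extension_def)

lemma linear_extension_zero [simp]: "linear_extension \<phi> 0 = 0"
  by (simp add: linear_extension_def)

lemma linear_extension_add:
  "linear_extension \<phi> (f + g) = linear_extension \<phi> f + linear_extension \<phi> g"
proof -
  let ?S = "Poly_Mapping.keys f \<union> Poly_Mapping.keys g"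
  have "finite ?S" "Poly_Mapping.keys (f + g) \<subseteq> ?S" by (auto simp: Poly_Mapping.keys_add)
  then show ?thesis
    using linear_extension_superset[of ?S f \<phi>] linear_extension_superset[of ?S g \<phi>]
      linear_extension_superset[of ?S "f + g" \<phi>]
    by (simp add: lookup_add scale_add_left sum.distrib)
qed

lemma linear_extension_scale: "linear_extension \<phi> (scale r f) = scale r (linear_extension \<phi> f)"
  \<comment> \<open>Scaling by 0 empties the keys, so the sum is taken over the keys of
    \<open>f\<close>, which contain those of \<open>scale r f\<close> for every
    \<open>r\<close>.\<close>
  using linear_extension_superset[OF finite_keys keys_scale, of \<phi> r f]
  by (simp add: lookup_scale scale_sum scale_scale linear_extension_def)

lemma linear_extension_sum:
  "linear_extension \<phi> (\<Sum>i\<in>I. f i) = (\<Sum>i\<in>I. linear_extension \<phi> (f i))"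
  by (induction I rule: infinite_finite_induct) (simp_all add: linear_extension_add)

lemma linear_extension_single [simp]:
  "linear_extension \<phi> (Poly_Mapping.single b r) = scale r (\<phi> b)"
  by (simp add: linear_extension_def)

lemma linear_extension_id [simp]: "linear_extension (\<lambda>b. Poly_Mapping.single b 1) f = f"
proof (rule poly_mapping_eqI)
  fix k
  have "Poly_Mapping.lookup (linear_extension (\<lambda>b. Poly_Mapping.single b 1) f) k =
      (\<Sum>b\<in>Poly_Mapping.keys f. if b = k then Poly_Mapping.lookup f b else 0)"
    unfolding linear_extension_def lookup_sum
    by (rule sum.cong) (simp_all add: lookup_scale lookup_single when_def)
  then show "Poly_Mapping.lookup (linear_extension (\<lambda>b. Poly_Mapping.single b 1) f) k =
      Poly_Mapping.lookup f k"
    by (auto simp: in_keys_iff)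
qed

lemma linear_extension_compose:
  "linear_extension \<phi> (linear_extension \<psi> f) = linear_extension (\<lambda>b. linear_extension \<phi> (\<psi> b)) f"
  by (simp add: linear_extension_def[of \<psi>] linear_extension_def[of "\<lambda>b. linear_extension \<phi> (\<psi> b)"]
      linear_extension_sum linear_extension_scale)

lemma linear_extension_add_fun:
  "linear_extension (\<lambda>b. \<phi> b + \<psi> b) f = linear_extension \<phi> f + linear_extension \<psi> f"
  by (simp add: linear_extension_def scale_add_right sum.distrib)

text \<open>Both sides are the same finite double sum. Associativity uses this to bring the sum over
  the third factor outside the sum over a product \<open>m b c\<close>.\<close>

lemma linear_extension_swap:
  "linear_extension (\<lambda>b. linear_extension (\<lambda>c. m b c) g) f =
   linear_extension (\<lambda>c. linear_extension (\<lambda>b. m b c) f) g"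
  by (simp add: linear_extension_def scale_sum scale_scale mult.commute)
     (rule sum.swap)

lemma keys_sum_subset:
  assumes "\<And>i. i \<in> I \<Longrightarrow> Poly_Mapping.keys (f i) \<subseteq> B"
  shows "Poly_Mapping.keys (\<Sum>i\<in>I. f i) \<subseteq> B"
  using assms
proof (induction I rule: infinite_finite_induct)
  case (insert i I)
  then show ?case using Poly_Mapping.keys_add[of "f i" "sum f I"] by fastforce
qed simp_all

lemma keys_linear_extension:
  assumes "\<And>b. b \<in> Poly_Mapping.keys f \<Longrightarrow> Poly_Mapping.keys (\<phi> b) \<subseteq> B"
  shows "Poly_Mapping.keys (linear_extension \<phi> f) \<subseteq> B"
  unfolding linear_extension_def by (intro keys_sum_subset order_trans[OF keys_scale assms])


section \<open>Algebras on a basis\<close>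

lemma algebra_on_basis_simps [simp]:
  "carrier (algebra_on_basis B m e) = {f. Poly_Mapping.keys f \<subseteq> B}"
  "\<one>\<^bsub>algebra_on_basis B m e\<^esub> = Poly_Mapping.single e 1"
  "\<zero>\<^bsub>algebra_on_basis B m e\<^esub> = 0"
  "f \<oplus>\<^bsub>algebra_on_basis B m e\<^esub> g = f + g"
  "r \<odot>\<^bsub>algebra_on_basis B m e\<^esub> f = scale r f"
  by (simp_all add: algebra_on_basis_def)

lemma algebra_on_basis_mult:
  "f \<otimes>\<^bsub>algebra_on_basis B m e\<^esub> g = linear_extension (\<lambda>b. linear_extension (m b) g) f"
  by (simp add: algebra_on_basis_def linear_extension_def scale_sum scale_scale)

text \<open>Distributivity holds for every bilinear product. Closure, the unit laws and
  associativity are expanded over the keys of the factors, which lie in \<open>B\<close>, where the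
  assumptions on \<open>m\<close> apply.\<close>

lemma ring_algebra_on_basis:
  fixes m :: "'b \<Rightarrow> 'b \<Rightarrow> ('b \<Rightarrow>\<^sub>0 rat)"
  assumes e: "e \<in> B"
    and closed: "\<And>b c. b \<in> B \<Longrightarrow> c \<in> B \<Longrightarrow> Poly_Mapping.keys (m b c) \<subseteq> B"
    and unit: "\<And>b. b \<in> B \<Longrightarrow> m e b = Poly_Mapping.single b 1"
      "\<And>b. b \<in> B \<Longrightarrow> m b e = Poly_Mapping.single b 1"
    and assoc: "\<And>b c d. b \<in> B \<Longrightarrow> c \<in> B \<Longrightarrow> d \<in> B \<Longrightarrow>
      linear_extension (\<lambda>x. m x d) (m b c) = linear_extension (m b) (m c d)"
  shows "ring (algebra_on_basis B m e)" (is "ring ?A")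
proof (rule ringI)
  show "abelian_group ?A"
  proof (rule abelian_groupI)
    fix f assume "f \<in> carrier ?A"
    then show "\<exists>g\<in>carrier ?A. g \<oplus>\<^bsub>?A\<^esub> f = \<zero>\<^bsub>?A\<^esub>"
      by (intro bexI[of _ "- f"]) auto
  qed (use Poly_Mapping.keys_add in \<open>fastforce simp: algebra_simps\<close>)+
  show "Group.monoid ?A"
  proof (rule monoidI)
    fix f g assume "f \<in> carrier ?A" "g \<in> carrier ?A"
    then show "f \<otimes>\<^bsub>?A\<^esub> g \<in> carrier ?A"
      unfolding algebra_on_basis_mult algebra_on_basis_simps mem_Collect_eq
      by (intro keys_linear_extension closed) (blast dest: subsetD)+
  next
    fix f g h assume "f \<in> carrier ?A" "g \<in> carrier ?A" "h \<in> carrier ?A"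
    then have fgh: "Poly_Mapping.keys f \<subseteq> B" "Poly_Mapping.keys g \<subseteq> B" "Poly_Mapping.keys h \<subseteq> B"
      by simp_all
    have "f \<otimes>\<^bsub>?A\<^esub> g \<otimes>\<^bsub>?A\<^esub> h = linear_extension (\<lambda>b. linear_extension (\<lambda>c.
        linear_extension (\<lambda>d. linear_extension (\<lambda>x. m x d) (m b c)) h) g) f"
      \<comment> \<open>The swap is applied to \<open>m b c\<close> and \<open>h\<close>, so that
        the innermost sum becomes the left side of \<open>assoc\<close>.\<close>
      unfolding algebra_on_basis_mult linear_extension_compose
        linear_extension_swap[where g = h and f = "m _ _"] ..
    also have "\<dots> = linear_extension (\<lambda>b. linear_extension (\<lambda>c.
        linear_extension (\<lambda>d. linear_extension (m b) (m c d)) h) g) f"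
      using fgh assoc by (intro linear_extension_cong) blast
    also have "\<dots> = f \<otimes>\<^bsub>?A\<^esub> (g \<otimes>\<^bsub>?A\<^esub> h)"
      by (simp add: algebra_on_basis_mult linear_extension_compose)
    finally show "f \<otimes>\<^bsub>?A\<^esub> g \<otimes>\<^bsub>?A\<^esub> h = f \<otimes>\<^bsub>?A\<^esub> (g \<otimes>\<^bsub>?A\<^esub> h)" .
  next
    fix f assume "f \<in> carrier ?A"
    then have f: "Poly_Mapping.keys f \<subseteq> B" by simp
    have "linear_extension (m e) f = linear_extension (\<lambda>b. Poly_Mapping.single b 1) f"
      using f unit by (intro linear_extension_cong) blast
    then show "\<one>\<^bsub>?A\<^esub> \<otimes>\<^bsub>?A\<^esub> f = f" by (simp add: algebra_on_basis_mult)
    have "linear_extension (\<lambda>b. m b e) f = linear_extension (\<lambda>b. Poly_Mapping.single b 1) f"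
      using f unit by (intro linear_extension_cong) blast
    then show "f \<otimes>\<^bsub>?A\<^esub> \<one>\<^bsub>?A\<^esub> = f" by (simp add: algebra_on_basis_mult)
  qed (use e in simp)
qed (simp_all add: algebra_on_basis_mult linear_extension_add linear_extension_add_fun)

section \<open>Quotients from surjective homomorphisms\<close>

text \<open>The first isomorphism theorem, with scalars added. The target is not assumed to be a
  ring: it becomes one as an image. Membership in \<open>ring_hom\<close> says nothing about zero,
  hence the assumption \<open>zero\<close>.\<close>

lemma is_quotient_of_surjective_hom:
  assumes "ring B" and h: "h \<in> ring_hom B A" and surj: "h ` carrier B = carrier A"
    and zero: "h \<zero>\<^bsub>B\<^esub> = \<zero>\<^bsub>A\<^esub>"
    and scalar_closed: "\<And>r x. x \<in> carrier B \<Longrightarrow> r \<odot>\<^bsub>B\<^esub> x \<in> carrier B"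
    and scalar: "\<And>r x. x \<in> carrier B \<Longrightarrow> h (r \<odot>\<^bsub>B\<^esub> x) = r \<odot>\<^bsub>A\<^esub> h x"
  shows "is_quotient_of A B"
proof -
  interpret B: ring B by fact
  \<comment> \<open>The image ring has the image of the carrier as carrier and the image of zero as
    zero; \<open>surj\<close> and \<open>zero\<close> identify this record with
    \<open>A\<close>.\<close>
  have "ring A" using B.ring_hom_imp_img_ring[OF h] surj zero by simp
  then interpret h: ring_hom_ring B A h using h by (intro ring_hom_ringI2 B.ring_axioms)
  define I where "I = a_kernel B A h"
  interpret I: ideal I B unfolding I_def by (rule h.kernel_is_ideal)
  define k where "k = (\<lambda>X. the_elem (h ` X))"
  \<comment> \<open>The induced map \<open>k\<close> goes from the quotient to \<open>A\<close>,
    whereas \<open>is_quotient_of\<close> asks for the opposite direction.\<close>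
  define g where "g = inv_into (carrier (B Quot I)) k"
  have k: "k \<in> ring_iso (B Quot I) A"
    unfolding k_def I_def by (rule h.FactRing_iso_set[OF surj])
  then have g: "g \<in> ring_iso A (B Quot I)"
    unfolding g_def by (rule ring_iso_set_sym[OF I.quotient_is_ring])
  have g_h: "g (h x) = I +>\<^bsub>B\<^esub> x" if x: "x \<in> carrier B" for x
  proof -
    have "I +>\<^bsub>B\<^esub> x \<in> carrier (B Quot I)"
      using I.rcos_ring_hom x by (simp add: ring_hom_closed)
    moreover have "k (I +>\<^bsub>B\<^esub> x) = h x" unfolding k_def I_def using x by simp
    moreover have "inj_on k (carrier (B Quot I))" using k by (simp add: ring_iso_def bij_betw_def)
    ultimately show ?thesis unfolding g_def by (metis inv_into_f_f)
  qed
  have "g (r \<odot>\<^bsub>A\<^esub> a) = (\<Union>y\<in>g a. I +>\<^bsub>B\<^esub> (r \<odot>\<^bsub>B\<^esub> y))" if "a \<in> carrier A" for r a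
  proof -
    from that surj obtain x where x: "x \<in> carrier B" "a = h x" by blast
    \<comment> \<open>Every representative \<open>y\<close> of the coset \<open>g a\<close>
      satisfies \<open>h y = a\<close>, so all sets in the union that defines scalar multiplication
      on the quotient are the same coset.\<close>
    have y: "I +>\<^bsub>B\<^esub> (r \<odot>\<^bsub>B\<^esub> y) = g (r \<odot>\<^bsub>A\<^esub> a)" if "y \<in> g a" for y
    proof -
      have yx: "y \<in> I +>\<^bsub>B\<^esub> x" using that x g_h by simp
      then have "y \<in> carrier B"
        using B.a_r_coset_subset_G[OF I.a_subset x(1)] by blast
      moreover from yx have "h y = a"
        using h.rcos_imp_homeq[OF x(1)] x(2) unfolding I_def by simp
      ultimately show ?thesis using g_h scalar scalar_closed by metis
    qed
    \<comment> \<open>The coset is nonempty, so the union of these equal sets is that set and not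
      \<open>{}\<close>.\<close>
    have "x \<in> g a" using I.a_rcos_self[OF x(1)] g_h x by simp
    then show ?thesis using y by blast
  qed
  then have "g \<in> algebra_iso A (quotient_algebra B I)"
    using g by (simp add: algebra_iso_def quotient_algebra_def ring_iso_def ring_hom_def)
  then show ?thesis using I.ideal_axioms unfolding is_quotient_of_def by blast
qed

text \<open>\<open>K\<close> may identify basis elements. The assumption \<open>mult\<close> fixes
  \<open>m'\<close> only at images under \<open>K\<close>, and these exhaust
  \<open>C\<close>.\<close>

lemma is_quotient_of_basis_map:
  assumes ring: "ring (algebra_on_basis B m e)"
    and closed: "\<And>b c. b \<in> B \<Longrightarrow> c \<in> B \<Longrightarrow> Poly_Mapping.keys (m b c) \<subseteq> B"
    and surj: "K ` B = C" and unit: "K e = e'"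
    and mult: "\<And>b c. b \<in> B \<Longrightarrow> c \<in> B \<Longrightarrow>
      linear_extension (\<lambda>x. Poly_Mapping.single (K x) 1) (m b c) = m' (K b) (K c)"
  shows "is_quotient_of (algebra_on_basis C m' e') (algebra_on_basis B m e)"
proof -
  define h where "h = linear_extension (\<lambda>x. Poly_Mapping.single (K x) 1)"
  let ?B = "algebra_on_basis B m e" and ?C = "algebra_on_basis C m' e'"
  have keys_h: "Poly_Mapping.keys (h f) \<subseteq> C" if "Poly_Mapping.keys f \<subseteq> B" for f
    unfolding h_def using that surj by (intro keys_linear_extension) auto
  have "h (f \<otimes>\<^bsub>?B\<^esub> g) = h f \<otimes>\<^bsub>?C\<^esub> h g"
    if fg: "Poly_Mapping.keys f \<subseteq> B" "Poly_Mapping.keys g \<subseteq> B" for f g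
  proof -
    have "h (f \<otimes>\<^bsub>?B\<^esub> g) = linear_extension (\<lambda>b. linear_extension (\<lambda>c. h (m b c)) g) f"
      by (simp add: algebra_on_basis_mult h_def linear_extension_compose)
    also have "\<dots> = linear_extension (\<lambda>b. linear_extension (\<lambda>c. m' (K b) (K c)) g) f"
      using fg mult unfolding h_def by (intro linear_extension_cong) blast
    also have "\<dots> = h f \<otimes>\<^bsub>?C\<^esub> h g"
      by (simp add: algebra_on_basis_mult h_def linear_extension_compose)
    finally show ?thesis .
  qed
  then have hom: "h \<in> ring_hom ?B ?C"
    using keys_h unit by (intro ring_hom_memI) (simp_all add: h_def linear_extension_add)
  have "f \<in> h ` carrier ?B" if f: "Poly_Mapping.keys f \<subseteq> C" for f
  proof
    \<comment> \<open>A section of \<open>K\<close> on \<open>C\<close>; pushing \<open>f\<close>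
      along it gives a preimage of \<open>f\<close> under \<open>h\<close>.\<close>
    define J where "J = inv_into B K"
    have J: "J c \<in> B" "K (J c) = c" if "c \<in> C" for c
      using that surj unfolding J_def by (auto intro: inv_into_into f_inv_into_f)
    define g where "g = linear_extension (\<lambda>c. Poly_Mapping.single (J c) 1) f"
    show "g \<in> carrier ?B"
      unfolding g_def algebra_on_basis_simps mem_Collect_eq
      by (intro keys_linear_extension) (use f J(1) in auto)
    have "h g = linear_extension (\<lambda>c. Poly_Mapping.single (K (J c)) 1) f"
      by (simp add: h_def g_def linear_extension_compose)
    also have "\<dots> = linear_extension (\<lambda>c. Poly_Mapping.single c 1) f"
      using f J(2) by (intro linear_extension_cong) (metis subsetD)
    finally show "f = h g" by simp
  qed
  then have "h ` carrier ?B = carrier ?C" using keys_h by auto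
  then show ?thesis
    by (rule is_quotient_of_surjective_hom[OF ring hom])
      (simp_all add: h_def linear_extension_scale order_trans[OF keys_scale])
qed


section \<open>Shuffles\<close>

lemma shuffles_map:
  "shuffles (map f xs) (map f ys) = map f ` shuffles xs ys"
  by (induction xs ys rule: shuffles.induct) (simp_all add: image_Un image_image)

text \<open>Deleting the letters of \<open>z\<close> from \<open>\<rho>\<close> recovers
  \<open>\<pi>\<close>, so the sets \<open>shuffles \<pi> z\<close> are disjoint and the double sum
  is one sum over their union. The resulting index set is symmetric in the three words.\<close>

lemma sum_shuffles_shuffles:
  fixes f :: "'a list \<Rightarrow> 'b::comm_monoid_add"
  assumes disj: "set x \<inter> set y = {}" "set x \<inter> set z = {}" "set y \<inter> set z = {}"
  shows "(\<Sum>\<pi>\<in>shuffles x y. \<Sum>\<rho>\<in>shuffles \<pi> z. f \<rho>) =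
    sum f {\<rho>. set \<rho> = set x \<union> set y \<union> set z \<and> filter (\<lambda>a. a \<in> set x) \<rho> = x \<and>
      filter (\<lambda>a. a \<in> set y) \<rho> = y \<and> filter (\<lambda>a. a \<in> set z) \<rho> = z}"
    (is "_ = sum f ?T")
proof -
  have \<pi>z: "set \<pi> \<inter> set z = {}" if "\<pi> \<in> shuffles x y" for \<pi>
    using set_shuffles[OF that] disj by auto
  have unique: "filter (\<lambda>a. a \<notin> set z) \<rho> = \<pi>" if "\<pi> \<in> shuffles x y" "\<rho> \<in> shuffles \<pi> z" for \<pi> \<rho>
    using filter_shuffles_disjoint2(2)[OF \<pi>z] that by blast
  have "(\<Union>\<pi>\<in>shuffles x y. shuffles \<pi> z) = ?T"
  proof (intro equalityI subsetI)
    fix \<rho> assume "\<rho> \<in> (\<Union>\<pi>\<in>shuffles x y. shuffles \<pi> z)"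
    then obtain \<pi> where \<pi>: "\<pi> \<in> shuffles x y" "\<rho> \<in> shuffles \<pi> z" by blast
    \<comment> \<open>Letters outside \<open>z\<close> occur in the same order in
      \<open>\<rho>\<close> and \<open>\<pi>\<close>, so the restrictions of \<open>\<rho>\<close>
      to \<open>x\<close> and \<open>y\<close> can be read off from \<open>\<pi>\<close>.\<close>
    have "filter P \<rho> = filter P \<pi>" if "\<And>a. P a \<Longrightarrow> a \<notin> set z" for P
      unfolding unique[OF \<pi>, symmetric] filter_filter using that by (metis)
    then have "filter (\<lambda>a. a \<in> set x) \<rho> = x" "filter (\<lambda>a. a \<in> set y) \<rho> = y"
      using filter_shuffles_disjoint1(1)[OF disj(1) \<pi>(1)]
        filter_shuffles_disjoint2(1)[OF disj(1) \<pi>(1)] disj(2,3) by (metis disjoint_iff)+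
    then show "\<rho> \<in> ?T"
      using filter_shuffles_disjoint2(1)[OF \<pi>z[OF \<pi>(1)] \<pi>(2)] set_shuffles[OF \<pi>(1)]
        set_shuffles[OF \<pi>(2)] by simp
  next
    fix \<rho> assume \<rho>: "\<rho> \<in> ?T"
    define \<pi> where "\<pi> = filter (\<lambda>a. a \<notin> set z) \<rho>"
    have "filter (\<lambda>a. a \<in> set x) \<pi> = filter (\<lambda>a. a \<in> set x) \<rho>"
      unfolding \<pi>_def filter_filter using disj(2) by (intro filter_cong) auto
    \<comment> \<open>\<open>\<rho>\<close> has no letters beyond those of the three words, so
      removing those of \<open>x\<close> and \<open>z\<close> leaves exactly those of
      \<open>y\<close>.\<close>
    moreover have "filter (\<lambda>a. a \<notin> set x) \<pi> = filter (\<lambda>a. a \<in> set y) \<rho>"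
      unfolding \<pi>_def filter_filter using disj \<rho> by (intro filter_cong) auto
    ultimately have "\<pi> \<in> shuffles x y"
      using partition_in_shuffles[of \<pi> "\<lambda>a. a \<in> set x"] \<rho> by simp
    moreover have "\<rho> \<in> shuffles \<pi> z"
      using partition_in_shuffles[of \<rho> "\<lambda>a. a \<in> set z"] \<rho>
      by (simp add: \<pi>_def shuffles_commutes)
    ultimately show "\<rho> \<in> (\<Union>\<pi>\<in>shuffles x y. shuffles \<pi> z)" by blast
  qed
  moreover have "sum f (\<Union>\<pi>\<in>shuffles x y. shuffles \<pi> z) =
      (\<Sum>\<pi>\<in>shuffles x y. \<Sum>\<rho>\<in>shuffles \<pi> z. f \<rho>)"
    using unique by (intro sum.UNION_disjoint) (simp, simp, blast)
  ultimately show ?thesis by simp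
qed

text \<open>By commutativity of shuffles the right side shuffles \<open>y\<close> with
  \<open>z\<close> first and then with \<open>x\<close>. The preceding lemma gives both sides the
  same index set, up to the order of its conditions.\<close>

lemma sum_shuffles_assoc:
  fixes f :: "'a list \<Rightarrow> 'b::comm_monoid_add"
  assumes "set x \<inter> set y = {}" "set x \<inter> set z = {}" "set y \<inter> set z = {}"
  shows "(\<Sum>\<pi>\<in>shuffles x y. \<Sum>\<rho>\<in>shuffles \<pi> z. f \<rho>) =
    (\<Sum>\<pi>\<in>shuffles y z. \<Sum>\<rho>\<in>shuffles x \<pi>. f \<rho>)"
proof -
  have "(\<Sum>\<pi>\<in>shuffles y z. \<Sum>\<rho>\<in>shuffles x \<pi>. f \<rho>) =
      (\<Sum>\<pi>\<in>shuffles y z. \<Sum>\<rho>\<in>shuffles \<pi> x. f \<rho>)"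
    by (rule sum.cong[OF refl]) (simp only: shuffles_commutes[of x])
  also have "\<dots> = sum f {\<rho>. set \<rho> = set y \<union> set z \<union> set x \<and>
      filter (\<lambda>a. a \<in> set y) \<rho> = y \<and> filter (\<lambda>a. a \<in> set z) \<rho> = z \<and>
      filter (\<lambda>a. a \<in> set x) \<rho> = x}"
    using assms by (intro sum_shuffles_shuffles) (simp_all add: Int_commute)
  also have "\<dots> = (\<Sum>\<pi>\<in>shuffles x y. \<Sum>\<rho>\<in>shuffles \<pi> z. f \<rho>)"
    unfolding sum_shuffles_shuffles[OF assms] by (rule arg_cong[where f = "sum f"]) blast
  finally show ?thesis ..
qed

section \<open>Shifts and shifted shuffles of standard permutations\<close>

lemma std_perms_subset: "\<SS> \<subseteq> \<PP>"
  by (auto simp: std_perms_def perms_def)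

lemma shift_perm:
  assumes "\<theta> \<in> \<PP>"
  shows "map (\<lambda>x. x + n) \<theta> \<in> \<PP>"
  using assms by (auto simp: perms_def distinct_map inj_on_def)

lemma std_shift: "std (map (\<lambda>x. x + n) \<theta>) = std \<theta>"
proof -
  have "card {y \<in> (\<lambda>x. x + n) ` set \<theta>. y \<le> x + n} = card {y \<in> set \<theta>. y \<le> x}" for x
  proof -
    have "{y \<in> (\<lambda>x. x + n) ` set \<theta>. y \<le> x + n} = (\<lambda>x. x + n) ` {y \<in> set \<theta>. y \<le> x}" by auto
    then show ?thesis by (simp add: card_image)
  qed
  then show ?thesis by (simp add: std_def)
qed

text \<open>Entries of a permutation are positive, so after the shift they exceed
  \<open>length \<tau>\<close>, which bounds the entries of \<open>\<tau>\<close>.\<close>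

lemma disjoint_perms_shift:
  assumes "\<tau> \<in> \<SS>" "\<theta> \<in> \<PP>"
  shows "disjoint_perms \<tau> (map (\<lambda>x. x + length \<tau>) \<theta>)"
  using assms by (auto simp: disjoint_perms_def std_perms_def perms_def)

lemma shifted_shuffles_std_perms:
  assumes "\<tau> \<in> \<SS>" "\<theta> \<in> \<SS>" "\<pi> \<in> shifted_shuffles \<tau> \<theta>"
  shows "\<pi> \<in> \<SS>"
proof -
  let ?\<theta> = "map (\<lambda>x. x + length \<tau>) \<theta>"
  have \<pi>: "\<pi> \<in> shuffles \<tau> ?\<theta>" using assms(3) by (simp add: shifted_shuffles_def)
  have "distinct \<pi>"
    using distinct_disjoint_shuffles[OF _ _ _ \<pi>] assms(1,2) disjoint_perms_shift[of \<tau> \<theta>]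
      std_perms_subset shift_perm[of \<theta> "length \<tau>"]
    by (auto simp: disjoint_perms_def perms_def)
  moreover have "set \<pi> = {1..length \<tau>} \<union> (\<lambda>x. x + length \<tau>) ` {1..length \<theta>}"
    using set_shuffles[OF \<pi>] assms(1,2) by (simp add: std_perms_def)
  \<comment> \<open>The shifted interval begins at \<open>length \<tau> + 1\<close>, so the two
    intervals join without a gap.\<close>
  then have "set \<pi> = {1..length \<pi>}"
    unfolding length_shuffles[OF \<pi>] image_add_atLeastAtMost' by (simp add: set_eq_iff) presburger
  ultimately show ?thesis by (simp add: std_perms_def)
qed

section \<open>The ring FQSym and its quotients\<close>

lemma keys_FQSym_mult:
  assumes "\<tau> \<in> \<SS>" "\<theta> \<in> \<SS>"
  shows "Poly_Mapping.keys (\<Sum>\<pi>\<in>shifted_shuffles \<tau> \<theta>. Poly_Mapping.single \<pi> (1::rat)) \<subseteq> \<SS>"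
proof (rule keys_sum_subset)
  fix \<pi> assume "\<pi> \<in> shifted_shuffles \<tau> \<theta>"
  then show "Poly_Mapping.keys (Poly_Mapping.single \<pi> (1::rat)) \<subseteq> \<SS>"
    using shifted_shuffles_std_perms[OF assms] by simp
qed

lemma ring_FQSym: "ring FQSym"
  unfolding FQSym_def
proof (rule ring_algebra_on_basis)
  show "[] \<in> \<SS>" by (simp add: std_perms_def)
  fix \<tau> \<theta> assume \<tau>\<theta>: "\<tau> \<in> \<SS>" "\<theta> \<in> \<SS>"
  then show "Poly_Mapping.keys (\<Sum>\<pi>\<in>shifted_shuffles \<tau> \<theta>. Poly_Mapping.single \<pi> (1::rat)) \<subseteq> \<SS>"
    by (rule keys_FQSym_mult)
  fix \<sigma> assume \<sigma>: "\<sigma> \<in> \<SS>"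
  let ?F = "\<lambda>\<pi>. Poly_Mapping.single \<pi> (1::rat)"
  \<comment> \<open>Every shuffle of \<open>\<tau>\<close> and \<open>?y\<close> has length
    \<open>length \<tau> + length \<theta>\<close>, so \<open>\<sigma>\<close> is shifted by the
    same amount in each term, giving \<open>?z\<close>.\<close>
  let ?y = "map (\<lambda>x. x + length \<tau>) \<theta>" and ?z = "map (\<lambda>x. x + (length \<tau> + length \<theta>)) \<sigma>"
  have "linear_extension (\<lambda>x. \<Sum>\<pi>\<in>shifted_shuffles x \<sigma>. ?F \<pi>) (\<Sum>\<pi>\<in>shifted_shuffles \<tau> \<theta>. ?F \<pi>) =
      (\<Sum>\<pi>\<in>shuffles \<tau> ?y. \<Sum>\<rho>\<in>shuffles \<pi> ?z. ?F \<rho>)"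
    by (simp add: linear_extension_sum shifted_shuffles_def length_shuffles cong: sum.cong)
  also have "\<dots> = (\<Sum>\<pi>\<in>shuffles ?y ?z. \<Sum>\<rho>\<in>shuffles \<tau> \<pi>. ?F \<rho>)"
    using \<tau>\<theta> \<sigma> by (intro sum_shuffles_assoc) (auto simp: std_perms_def)
  \<comment> \<open>The shift in \<open>?z\<close> is the one by \<open>length \<theta>\<close>
    followed by the one by \<open>length \<tau>\<close>. The latter is common to both words and
    \<open>shuffles_map\<close> pulls it out.\<close>
  also have "shuffles ?y ?z = map (\<lambda>x. x + length \<tau>) ` shifted_shuffles \<theta> \<sigma>"
    unfolding shifted_shuffles_def by (subst shuffles_map[symmetric]) (simp_all add: comp_def ac_simps)
  also have "(\<Sum>\<pi>\<in>map (\<lambda>x. x + length \<tau>) ` shifted_shuffles \<theta> \<sigma>. \<Sum>\<rho>\<in>shuffles \<tau> \<pi>. ?F \<rho>) =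
      (\<Sum>\<pi>\<in>shifted_shuffles \<theta> \<sigma>. \<Sum>\<rho>\<in>shifted_shuffles \<tau> \<pi>. ?F \<rho>)"
    \<comment> \<open>Shifting is injective on words, so no terms merge.\<close>
    by (subst sum.reindex) (simp_all add: shifted_shuffles_def inj_on_def inj_map_eq_map)
  finally show "linear_extension (\<lambda>x. \<Sum>\<pi>\<in>shifted_shuffles x \<sigma>. ?F \<pi>)
      (\<Sum>\<pi>\<in>shifted_shuffles \<tau> \<theta>. ?F \<pi>) =
    linear_extension (\<lambda>\<theta>. \<Sum>\<pi>\<in>shifted_shuffles \<tau> \<theta>. ?F \<pi>) (\<Sum>\<pi>\<in>shifted_shuffles \<theta> \<sigma>. ?F \<pi>)"
    by (simp add: linear_extension_sum)
next
  fix \<tau> :: "nat list"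
  show "(\<Sum>\<pi>\<in>shifted_shuffles [] \<tau>. Poly_Mapping.single \<pi> 1) = Poly_Mapping.single \<tau> (1::rat)"
    by (simp add: shifted_shuffles_def)
  show "(\<Sum>\<pi>\<in>shifted_shuffles \<tau> []. Poly_Mapping.single \<pi> 1) = Poly_Mapping.single \<tau> (1::rat)"
    by (simp add: shifted_shuffles_def)
qed

text \<open>The common form of both halves of the theorem: \<open>K\<close> will send a permutation
  to its class within \<SS> or within \<PP>.\<close>

lemma is_quotient_of_FQSym:
  assumes "K ` \<SS> = C" "K [] = e"
    and "\<And>\<tau> \<theta>. \<tau> \<in> \<SS> \<Longrightarrow> \<theta> \<in> \<SS> \<Longrightarrow>
      m (K \<tau>) (K \<theta>) = (\<Sum>\<pi>\<in>shifted_shuffles \<tau> \<theta>. Poly_Mapping.single (K \<pi>) 1)"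
  shows "is_quotient_of (algebra_on_basis C m e) FQSym"
  unfolding FQSym_def
proof (rule is_quotient_of_basis_map[where K = K])
  fix \<tau> \<theta> assume "\<tau> \<in> \<SS>" "\<theta> \<in> \<SS>"
  then show "Poly_Mapping.keys (\<Sum>\<pi>\<in>shifted_shuffles \<tau> \<theta>. Poly_Mapping.single \<pi> (1::rat)) \<subseteq> \<SS>"
    by (rule keys_FQSym_mult)
  show "linear_extension (\<lambda>x. Poly_Mapping.single (K x) 1)
      (\<Sum>\<pi>\<in>shifted_shuffles \<tau> \<theta>. Poly_Mapping.single \<pi> 1) = m (K \<tau>) (K \<theta>)"
    using assms(3) \<open>\<tau> \<in> \<SS>\<close> \<open>\<theta> \<in> \<SS>\<close> by (simp add: linear_extension_sum)
qed (use assms(1,2) ring_FQSym in \<open>simp_all add: FQSym_def\<close>)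


section \<open>Standardization\<close>

text \<open>The count at \<open>b\<close> includes \<open>b\<close> itself, while the count at a
  smaller element does not.\<close>

lemma strict_mono_on_rank:
  fixes A :: "'a::linorder set"
  assumes "finite A"
  shows "strict_mono_on A (\<lambda>x. card {y \<in> A. y \<le> x})"
proof (rule strict_mono_onI)
  fix a b assume ab: "a \<in> A" "b \<in> A" "a < b"
  then have "b \<in> {y \<in> A. y \<le> b} - {y \<in> A. y \<le> a}" by simp
  moreover have "{y \<in> A. y \<le> a} \<subseteq> {y \<in> A. y \<le> b}" using ab by auto
  ultimately have "{y \<in> A. y \<le> a} \<subset> {y \<in> A. y \<le> b}" by blast
  then show "card {y \<in> A. y \<le> a} < card {y \<in> A. y \<le> b}"
    using assms by (intro psubset_card_mono) simp_all
qed

lemma length_std [simp]: "length (std \<pi>) = length \<pi>"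
  by (simp add: std_def)

text \<open>The ranks are distinct and lie between 1 and the length, so by counting they take every
  value in that range.\<close>

lemma std_std_perms:
  assumes "\<pi> \<in> \<PP>"
  shows "std \<pi> \<in> \<SS>"
proof -
  let ?r = "\<lambda>x. card {y \<in> set \<pi>. y \<le> x}"
  have d: "distinct \<pi>" using assms by (simp add: perms_def)
  have inj: "inj_on ?r (set \<pi>)"
    by (intro strict_mono_on_imp_inj_on strict_mono_on_rank) simp
  have "?r ` set \<pi> \<subseteq> {1..length \<pi>}"
  proof
    fix k assume "k \<in> ?r ` set \<pi>"
    then obtain x where x: "x \<in> set \<pi>" "k = ?r x" by blast
    have "k \<le> card (set \<pi>)" unfolding x by (rule card_mono) auto
    \<comment> \<open>An entry counts itself, so no rank is 0.\<close>
    moreover have "0 < k" unfolding x using x(1) by (subst card_gt_0_iff) auto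
    ultimately show "k \<in> {1..length \<pi>}" using distinct_card[OF d] by simp
  qed
  moreover have "card (?r ` set \<pi>) = card {1..length \<pi>}"
    using card_image[OF inj] distinct_card[OF d] by simp
  ultimately have "?r ` set \<pi> = {1..length \<pi>}" by (intro card_subset_eq) auto
  then show ?thesis using d inj by (simp add: std_perms_def std_def distinct_map)
qed

lemma std_id:
  assumes "\<pi> \<in> \<SS>"
  shows "std \<pi> = \<pi>"
  unfolding std_def
proof (rule map_idI)
  fix x assume "x \<in> set \<pi>"
  then have "{y \<in> set \<pi>. y \<le> x} = {1..x}" using assms by (auto simp: std_perms_def)
  then show "card {y \<in> set \<pi>. y \<le> x} = x" by simp
qed

section \<open>Classes of a shuffle-compatible statistic\<close>

lemma shuffle_compatible_std:
  assumes "shuffle_compatible st" "\<tau> \<in> \<PP>" "\<theta> \<in> \<PP>" "std \<tau> = std \<theta>"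
  shows "st \<tau> = st \<theta>"
  using assms unfolding shuffle_compatible_def by blast

lemma st_class_std_perms:
  assumes "shuffle_compatible st"
  shows "st_class \<PP> st ` \<SS> = st_class \<PP> st ` \<PP>"
proof
  show "st_class \<PP> st ` \<SS> \<subseteq> st_class \<PP> st ` \<PP>" using std_perms_subset by blast
  show "st_class \<PP> st ` \<PP> \<subseteq> st_class \<PP> st ` \<SS>"
  proof (rule image_subsetI)
    fix \<pi> assume \<pi>: "\<pi> \<in> \<PP>"
    note s = std_std_perms[OF \<pi>]
    \<comment> \<open>By \<open>std_id\<close>, \<open>std \<pi>\<close> is its own standardization,
      so it and \<open>\<pi>\<close> have the same one and the invariance clause of compatibility
      applies.\<close>
    have "st (std \<pi>) = st \<pi>"
      using shuffle_compatible_std[OF assms] s \<pi> std_id[OF s] std_perms_subset by blast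
    then have "st_class \<PP> st \<pi> = st_class \<PP> st (std \<pi>)" by (simp add: st_class_def)
    with s show "st_class \<PP> st \<pi> \<in> st_class \<PP> st ` \<SS>" by blast
  qed
qed

text \<open>Two standard permutations usually share entries, so \<open>shuffle_product_eq\<close> is
  applied to \<open>\<tau>\<close> and the shift of \<open>\<theta>\<close>, which represents the
  same class.\<close>

lemma shuffle_product_shifted:
  assumes sc: "shuffle_compatible st" and "\<tau> \<in> \<SS>" "\<theta> \<in> \<SS>"
  shows "shuffle_product st (st_class \<PP> st \<tau>) (st_class \<PP> st \<theta>) =
    (\<Sum>\<pi>\<in>shifted_shuffles \<tau> \<theta>. Poly_Mapping.single (st_class \<PP> st \<pi>) 1)"
proof -
  let ?\<theta> = "map (\<lambda>x. x + length \<tau>) \<theta>"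
  have P: "\<tau> \<in> \<PP>" "\<theta> \<in> \<PP>" using assms std_perms_subset by blast+
  then have "st ?\<theta> = st \<theta>"
    using shuffle_compatible_std[OF sc] shift_perm std_shift by blast
  then have "st_class \<PP> st \<theta> = st_class \<PP> st ?\<theta>" by (simp add: st_class_def)
  then show ?thesis
    using shuffle_product_eq[OF sc P(1) shift_perm[OF P(2)] disjoint_perms_shift[OF assms(2) P(2)]]
    by (simp add: shifted_shuffles_def)
qed

theorem theorem2p4:
  fixes st :: "nat list \<Rightarrow> 'a"
  shows "(weakly_shuffle_compatible st \<longrightarrow> is_quotient_of (shifted_shuffle_algebra st) FQSym) \<and>
         (shuffle_compatible st \<longrightarrow> is_quotient_of (shuffle_algebra st) FQSym)"
  unfolding shifted_shuffle_algebra_def shuffle_algebra_def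
proof (intro conjI impI)
  assume "weakly_shuffle_compatible st"
  then show "is_quotient_of (algebra_on_basis (st_class \<SS> st ` \<SS>) (shifted_shuffle_product st)
      (st_class \<SS> st [])) FQSym"
    \<comment> \<open>The basis is by definition the image of \<SS> under \<open>K\<close>, so
      surjectivity is immediate.\<close>
    by (intro is_quotient_of_FQSym[where K = "st_class \<SS> st"] shifted_shuffle_product_eq) auto
next
  assume "shuffle_compatible st"
  then show "is_quotient_of (algebra_on_basis (st_class \<PP> st ` \<PP>) (shuffle_product st)
      (st_class \<PP> st [])) FQSym"
    \<comment> \<open>Here the basis is the image of all of \<PP>, and standardization reduces it to
      the image of \<SS>.\<close>
    by (intro is_quotient_of_FQSym[where K = "st_class \<PP> st"] st_class_std_perms
        shuffle_product_shifted) auto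
qed

end
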